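(* Let $\phi:\mathbb{R}^+\to\mathbb{R}^+$ be an eventually log-convex function such that $\lim_{n\to\infty}\frac{\phi(n)}{\phi(n+1)}=1$ (limit over positive integers $n$). Then there exists a function $\widetilde W_\phi$ on $\mathbb{R}^+$ satisfying the functional equation $\widetilde W_\phi(x+1)=\phi(x)\,\widetilde W_\phi(x)$ for all $x\in\mathbb{R}^+$, with the initial condition $\widetilde W_\phi(1)=1$. Moreover, for every $x>0$, $$\widetilde W_\phi(x)=\lim_{n\to\infty}\frac{\phi(n)\,\phi(n-1)\cdots\phi(1)\,(\phi(n))^{x}}{\phi(n+x)\,\phi(n-1+x)\cdots\phi(1+x)\,\phi(x)}.$$
   Context: $\mathbb{R}^+=(0,\infty)$. A positive function $g$ on $\mathbb{R}^+$ is log-convex on an interval if $\log g$ is convex there. It is eventually log-convex if there exists $m\in\mathbb{R}$ such that $\log g$ is convex on $(m,\infty)$ (intersected with the domain of $g$). The "moreover" part means that the function $\widetilde W_\phi$ whose existence is asserted is given by the displayed limit, which in particular exists for every $x>0$. *)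

theory Defs
  imports "HOL-Analysis.Analysis"
begin

(* Positivity is included because ln is total on the reals and carries no
   information about the sign of its argument. *)
definition log_convex_on :: "real set \<Rightarrow> (real \<Rightarrow> real) \<Rightarrow> bool" where
  "log_convex_on I g \<longleftrightarrow> (\<forall>x\<in>I. 0 < g x) \<and> convex_on I (\<lambda>x. ln (g x))"

(* The domain of g is (0, \<infinity>), so the half-line (m, \<infinity>) is intersected with it. *)
definition eventually_log_convex :: "(real \<Rightarrow> real) \<Rightarrow> bool" where
  "eventually_log_convex g \<longleftrightarrow> (\<exists>m::real. log_convex_on ({m<..} \<inter> {0<..}) g)"

end

theory Submission
  imports Defs
begin

text \<open>
  This is the existence half of a theorem of Bohr--Mollerup type: \<open>\<phi> x\<close> takes the place of the
  factor in the functional equation of the Gamma function, and the displayed quotient that of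
  Gauss's product. For \<open>\<phi> x = 1 / x\<close> the quotient is the reciprocal of Gauss's product and its
  limit is \<open>1 / \<Gamma>\<close>.

  Put \<open>f = ln \<circ> \<phi>\<close> and \<open>d n = f (n + 1) - f n\<close>; the hypothesis on ratios says \<open>d n \<longlonglongrightarrow> 0\<close>.
  Passing from index \<open>n\<close> to \<open>n + 1\<close> lowers the logarithm of the Gauss quotient by
  \<open>t n = f (n + 1 + x) - f (n + 1) - x * d n\<close>.
  Since the slopes of a convex function increase, for large \<open>n\<close> the slope of \<open>f\<close> over
  \<open>[n + 1, n + 1 + x]\<close> lies between \<open>d n\<close> and \<open>d (n + N + 1)\<close>, where \<open>N \<ge> x\<close> is an integer, so
  \<open>0 \<le> t n \<le> x * (d (n + N + 1) - d n)\<close>. The upper bound telescopes over a lag of \<open>N + 1\<close> and \<open>d\<close>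
  converges, so \<open>\<Sum>t\<close> converges, and with it the Gauss quotients, to a limit that is the exponential
  of a real number (lemma \<open>gauss_quotient_convergent\<close>).

  For the functional equation, the Gauss quotients at \<open>x + 1\<close> and at \<open>x\<close> differ by the factor
  \<open>\<phi> x * (\<phi> n / \<phi> (n + 1 + x))\<close>. Summability of \<open>t\<close> also gives \<open>t n \<longlonglongrightarrow> 0\<close>, hence
  \<open>f (n + 1 + x) - f n = t n + (x + 1) * d n \<longlonglongrightarrow> 0\<close>, and the last ratio tends to \<open>1\<close>
  (lemma \<open>shifted_ratio_tendsto_1\<close>).
\<close>

definition gauss_quotient :: "(real \<Rightarrow> real) \<Rightarrow> real \<Rightarrow> nat \<Rightarrow> real" where
  "gauss_quotient \<phi> x n =
     (\<Prod>k=1..n. \<phi> (real k)) * \<phi> (real n) powr x / (\<Prod>k=0..n. \<phi> (real k + x))"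

text \<open>Both slopes are compared with the slope over the long interval \<open>[a, d]\<close>.\<close>

lemma convex_on_slope_mono:
  fixes f :: "real \<Rightarrow> real"
  assumes "convex_on I f" "a \<in> I" "d \<in> I" "a < b" "b \<le> c" "c < d"
  shows "(f b - f a) / (b - a) \<le> (f d - f c) / (d - c)"
proof -
  have flip: "(u - v) / (p - q) = (v - u) / (q - p)" for u v p q :: real
    by (metis minus_diff_eq minus_divide_divide)
  have "(f a - f b) / (a - b) \<le> (f a - f d) / (a - d)"
    by (rule convex_on_slope_le(1)[OF assms(1-3)]) (use assms in auto)
  also have "\<dots> \<le> (f c - f d) / (c - d)"
    by (rule convex_on_slope_le(2)[OF assms(1-3)]) (use assms in auto)
  finally show ?thesis
    using flip[of "f a" "f b" a b] flip[of "f c" "f d" c d] by simp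
qed

lemma summable_lagged_difference:
  fixes u :: "nat \<Rightarrow> real"
  assumes "u \<longlonglongrightarrow> c"
  shows "summable (\<lambda>n. u (n + M) - u n)"
proof (induction M)
  case (Suc M)
  have "(\<lambda>n. u (n + M)) \<longlonglongrightarrow> c"
    using assms by (rule LIMSEQ_ignore_initial_segment)
  from summable_add[OF telescope_summable[OF this] Suc.IH] show ?case
    by simp
qed simp

text \<open>
  The decrements of the logarithm of the Gauss quotient are squeezed between \<open>0\<close> and a
  telescoping sequence, because a chord of \<open>f\<close> over \<open>[n + 1, n + 1 + x]\<close> has a slope between
  those of a unit chord before it and a unit chord after it.
\<close>

lemma summable_decrements:
  fixes f :: "real \<Rightarrow> real"
  assumes conv: "convex_on ({m<..} \<inter> {0<..}) f"
    and lim: "(\<lambda>n. f (real n + 1) - f (real n)) \<longlonglongrightarrow> 0"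
    and x: "0 < x"
  shows "summable (\<lambda>n. f (real n + 1 + x) - f (real n + 1) - x * (f (real n + 1) - f (real n)))"
    (is "summable ?t")
proof -
  define d where "d n = f (real n + 1) - f (real n)" for n :: nat
  define N where "N = nat \<lceil>x\<rceil>"
  have xN: "x \<le> real N"
    unfolding N_def by linarith
  have "summable (\<lambda>n. d (n + (N + 1)) - d n)"
    using lim unfolding d_def by (rule summable_lagged_difference)
  then have "summable (\<lambda>n. x * (d (n + (N + 1)) - d n))"
    by (rule summable_mult)
  then show ?thesis
  proof (rule summable_comparison_test'[where N = "nat \<lceil>m\<rceil> + 1"])
    fix n assume n: "n \<ge> nat \<lceil>m\<rceil> + 1"
    then have I: "y \<in> {m<..} \<inter> {0<..}" if "y \<ge> real n" for y
      using that by simp linarith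
    have "(f (real n + 1) - f (real n)) / (real n + 1 - real n)
        \<le> (f (real n + 1 + x) - f (real n + 1)) / (real n + 1 + x - (real n + 1))"
      using x by (intro convex_on_slope_mono[OF conv] I) auto
    then have lower: "x * d n \<le> f (real n + 1 + x) - f (real n + 1)"
      using x by (simp add: d_def field_simps)
    have "(f (real n + 1 + x) - f (real n + 1)) / (real n + 1 + x - (real n + 1))
        \<le> (f (real (n + (N + 1)) + 1) - f (real (n + (N + 1))))
            / (real (n + (N + 1)) + 1 - real (n + (N + 1)))"
      using x xN by (intro convex_on_slope_mono[OF conv] I) auto
    then have "(f (real n + 1 + x) - f (real n + 1)) / x \<le> d (n + (N + 1))"
      by (simp add: d_def)
    then have "f (real n + 1 + x) - f (real n + 1) \<le> x * d (n + (N + 1))"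
      using x by (simp add: pos_divide_le_eq mult.commute)
    with lower show "norm (?t n) \<le> x * (d (n + (N + 1)) - d n)"
      by (simp add: d_def algebra_simps)
  qed
qed

context
  fixes \<phi> :: "real \<Rightarrow> real" and m :: real
  assumes pos: "\<And>x. 0 < x \<Longrightarrow> 0 < \<phi> x"
    and conv: "convex_on ({m<..} \<inter> {0<..}) (\<lambda>x. ln (\<phi> x))"
    and ratio: "(\<lambda>n::nat. \<phi> (real n) / \<phi> (real (n + 1))) \<longlonglongrightarrow> 1"
begin

lemma ln_step_tendsto_0: "(\<lambda>n. ln (\<phi> (real n + 1)) - ln (\<phi> (real n))) \<longlonglongrightarrow> 0"
proof -
  have "(\<lambda>n::nat. - ln (\<phi> (real n) / \<phi> (real (n + 1)))) \<longlonglongrightarrow> - ln 1"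
    using ratio by (intro tendsto_intros) auto
  moreover have "\<forall>\<^sub>F n in sequentially.
      - ln (\<phi> (real n) / \<phi> (real (n + 1))) = ln (\<phi> (real n + 1)) - ln (\<phi> (real n))"
    using eventually_gt_at_top[of 0]
  proof eventually_elim
    case (elim n)
    then have "0 < \<phi> (real n)" "0 < \<phi> (real n + 1)"
      by (auto intro: pos)
    then show ?case
      by (simp add: ln_div add.commute)
  qed
  ultimately show ?thesis
    by (simp cong: filterlim_cong add: tendsto_cong)
qed

lemmas summable_ln_decrements = summable_decrements[OF conv ln_step_tendsto_0]

lemma gauss_quotient_convergent:
  assumes x: "0 < x"
  shows "convergent (gauss_quotient \<phi> x)"
proof -
  define f where "f y = ln (\<phi> y)" for y
  define L where
    "L n = (\<Sum>k=1..n. f (real k)) + x * f (real n) - (\<Sum>k=0..n. f (real k + x))" for n :: nat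
  define t where
    "t n = f (real n + 1 + x) - f (real n + 1) - x * (f (real n + 1) - f (real n))" for n :: nat
  have step: "L (Suc n) - L n = - t n" for n
    by (simp add: L_def t_def algebra_simps)
  have "summable (\<lambda>n. L (Suc n) - L n)"
    using summable_ln_decrements[OF x] unfolding step t_def f_def by (rule summable_minus)
  then have "convergent (\<lambda>n. L n - L 0)"
    by (simp only: summable_iff_convergent sum_lessThan_telescope)
  then have "convergent L"
    using convergent_diff_const_right_iff by blast
  then have "convergent (\<lambda>n. exp (L n))"
    unfolding convergent_def by (blast intro: tendsto_exp)
  moreover have "\<forall>\<^sub>F n in sequentially. exp (L n) = gauss_quotient \<phi> x n"
    \<comment> \<open>\<open>\<phi> 0\<close> is an arbitrary real, so the logarithm is only meaningful from index \<open>1\<close> on.\<close>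
    using eventually_gt_at_top[of 0]
  proof eventually_elim
    case (elim n)
    have "exp (f y) = \<phi> y" if "0 < y" for y
      using pos[OF that] by (simp add: f_def)
    moreover have "\<phi> (real n) powr x = exp (x * f (real n))"
      using pos[of "real n"] elim by (simp add: powr_def f_def)
    ultimately show ?case
      using x by (simp add: L_def gauss_quotient_def exp_diff exp_add exp_sum)
  qed
  ultimately show ?thesis
    using convergent_cong by fast
qed

text \<open>
  Convexity is what controls \<open>\<phi>\<close> at the shifted points \<open>n + 1 + x\<close>, since the hypothesis on ratios
  only speaks of integers: the terms of a convergent series tend to \<open>0\<close>.
\<close>

lemma shifted_ratio_tendsto_1:
  assumes x: "0 < x"
  shows "(\<lambda>n. \<phi> (real n) / \<phi> (real n + 1 + x)) \<longlonglongrightarrow> 1"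
proof -
  define f where "f y = ln (\<phi> y)" for y
  have t: "(\<lambda>n. f (real n + 1 + x) - f (real n + 1) - x * (f (real n + 1) - f (real n))) \<longlonglongrightarrow> 0"
    using summable_LIMSEQ_zero[OF summable_ln_decrements[OF x]] by (simp add: f_def)
  have d: "(\<lambda>n. f (real n + 1) - f (real n)) \<longlonglongrightarrow> 0"
    using ln_step_tendsto_0 by (simp add: f_def)
  have "(\<lambda>n. exp (- ((f (real n + 1 + x) - f (real n + 1) - x * (f (real n + 1) - f (real n)))
            + (x + 1) * (f (real n + 1) - f (real n))))) \<longlonglongrightarrow> exp (- (0 + (x + 1) * 0))"
    by (intro tendsto_intros t d)
  moreover have "- ((f (real n + 1 + x) - f (real n + 1) - x * (f (real n + 1) - f (real n)))
            + (x + 1) * (f (real n + 1) - f (real n))) = f (real n) - f (real n + 1 + x)" for n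
    by (simp add: algebra_simps)
  ultimately have "(\<lambda>n. exp (f (real n) - f (real n + 1 + x))) \<longlonglongrightarrow> 1"
    by (simp only: mult_zero_right add_0_left minus_zero exp_zero)
  moreover have "\<forall>\<^sub>F n in sequentially.
      exp (f (real n) - f (real n + 1 + x)) = \<phi> (real n) / \<phi> (real n + 1 + x)"
    using eventually_gt_at_top[of 0]
  proof eventually_elim
    case (elim n)
    then show ?case
      using pos[of "real n"] pos[of "real n + 1 + x"] x by (simp add: f_def exp_diff)
  qed
  ultimately show ?thesis
    by (rule Lim_transform_eventually)
qed

lemma gauss_quotient_shift:
  assumes x: "0 < x" and n: "0 < n"
  shows "gauss_quotient \<phi> (x + 1) n
       = \<phi> x * (\<phi> (real n) / \<phi> (real n + 1 + x)) * gauss_quotient \<phi> x n"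
proof -
  define A where "A = (\<Prod>k=0..n. \<phi> (real k + x))"
  define B where "B = (\<Prod>k=0..n. \<phi> (real k + (x + 1)))"
  have nz: "\<phi> y \<noteq> 0" if "0 < y" for y
    using pos[OF that] by simp
  have "\<phi> x * B = (\<Prod>k=0..Suc n. \<phi> (real k + x))"
    unfolding B_def by (subst prod.atLeast0_atMost_Suc_shift) (simp add: o_def add_ac)
  also have "\<dots> = A * \<phi> (real n + 1 + x)"
    by (simp add: A_def add_ac)
  finally have AB: "\<phi> x * B = A * \<phi> (real n + 1 + x)" .
  have "A \<noteq> 0" "B \<noteq> 0"
    using x nz by (auto simp: A_def B_def)
  moreover have "\<phi> (real n + 1 + x) \<noteq> 0"
    using x by (intro nz) simp
  moreover have "\<phi> (real n) powr (x + 1) = \<phi> (real n) powr x * \<phi> (real n)"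
    using pos[of "real n"] n by (simp add: powr_add)
  ultimately show ?thesis
    using AB unfolding gauss_quotient_def A_def[symmetric] B_def[symmetric]
    by (simp add: field_simps)
qed

lemma gauss_quotient_1:
  assumes "0 < n"
  shows "gauss_quotient \<phi> 1 n = \<phi> (real n) / \<phi> (real (n + 1))"
proof -
  define P where "P = (\<Prod>k=1..n. \<phi> (real k))"
  have "P \<noteq> 0"
    using pos by (auto simp: P_def less_imp_neq[symmetric])
  have "(\<Prod>k=0..n. \<phi> (real k + 1)) = (\<Prod>k=1..Suc n. \<phi> (real k))"
    using prod.atLeast_Suc_atMost_Suc_shift[of "\<lambda>k. \<phi> (real k)" 0 n]
    by (simp add: o_def add.commute)
  also have "\<dots> = P * \<phi> (real (n + 1))"
    by (simp add: P_def)
  finally show ?thesis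
    using \<open>P \<noteq> 0\<close> pos[of "real n"] assms
    unfolding gauss_quotient_def P_def[symmetric] by simp
qed

end

theorem theorem4p1:
  fixes \<phi> :: "real \<Rightarrow> real"
  assumes "\<And>x. 0 < x \<Longrightarrow> 0 < \<phi> x"
    and "eventually_log_convex \<phi>"
    and "(\<lambda>n::nat. \<phi> (real n) / \<phi> (real (n + 1))) \<longlonglongrightarrow> 1"
  shows "\<exists>W :: real \<Rightarrow> real.
           (\<forall>x>0. W (x + 1) = \<phi> x * W x) \<and>
           W 1 = 1 \<and>
           (\<forall>x>0. (\<lambda>n::nat. (\<Prod>k=1..n. \<phi> (real k)) * \<phi> (real n) powr x
                              / (\<Prod>k=0..n. \<phi> (real k + x))) \<longlonglongrightarrow> W x)"
proof -
  obtain m where conv: "convex_on ({m<..} \<inter> {0<..}) (\<lambda>x. ln (\<phi> x))"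
    using assms(2) by (auto simp: eventually_log_convex_def log_convex_on_def)
  note facts = assms(1) conv assms(3)
  define W where "W x = lim (gauss_quotient \<phi> x)" for x
  have W: "gauss_quotient \<phi> x \<longlonglongrightarrow> W x" if "0 < x" for x
    using gauss_quotient_convergent[OF facts that] by (simp add: W_def convergent_LIMSEQ_iff)
  have "W (x + 1) = \<phi> x * W x" if x: "0 < x" for x
  proof -
    have "(\<lambda>n. \<phi> x * (\<phi> (real n) / \<phi> (real n + 1 + x)) * gauss_quotient \<phi> x n)
        \<longlonglongrightarrow> \<phi> x * 1 * W x"
      by (intro tendsto_intros W shifted_ratio_tendsto_1[OF facts] x)
    moreover have "\<forall>\<^sub>F n in sequentially.
        \<phi> x * (\<phi> (real n) / \<phi> (real n + 1 + x)) * gauss_quotient \<phi> x n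
        = gauss_quotient \<phi> (x + 1) n"
      using eventually_gt_at_top[of 0]
      by eventually_elim (simp only: gauss_quotient_shift[OF facts x])
    ultimately have "gauss_quotient \<phi> (x + 1) \<longlonglongrightarrow> \<phi> x * 1 * W x"
      by (rule Lim_transform_eventually)
    with W[of "x + 1"] x show ?thesis
      using LIMSEQ_unique by fastforce
  qed
  moreover have "W 1 = 1"
  proof -
    have "\<forall>\<^sub>F n in sequentially. \<phi> (real n) / \<phi> (real (n + 1)) = gauss_quotient \<phi> 1 n"
      using eventually_gt_at_top[of 0]
      by eventually_elim (simp only: gauss_quotient_1[OF facts])
    with assms(3) have "gauss_quotient \<phi> 1 \<longlonglongrightarrow> 1"
      by (rule Lim_transform_eventually)
    with W[of 1] show ?thesis
      using LIMSEQ_unique by fastforce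
  qed
  ultimately show ?thesis
    using W unfolding gauss_quotient_def[abs_def] by blast
qed

end
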